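(* Let $d\ge2$ and let $\{I_g\}_{g=1}^G$ be a partition of $\{1,\dots,d\}$. For $k=1,2$, let $R_k$ be a $G$-variate copula and let $A_{k,g}$ be a copula on the coordinate block $I_g$, $g=1,\dots,G$. Assume that the functions $$C_k(u):=R_k\bigl(A_{k,1}(u_{I_1}),\dots,A_{k,G}(u_{I_G})\bigr),\qquad u\in[0,1]^d,\quad k=1,2,$$ are copulas. Then $$\mathrm d_K(C_1,C_2)\le\mathrm d_K(R_1,R_2)+\sum_{g=1}^G\mathrm d_K(A_{1,g},A_{2,g}).$$
   Context: For $u\in[0,1]^d$ and $I\subset\{1,\dots,d\}$, $u_I=(u_i)_{i\in I}$. An $m$-variate copula is the restriction to $[0,1]^m$ of a distribution function with uniform margins on $[0,1]$; a copula on the block $I_g$ is an $|I_g|$-variate copula in the variables $u_{I_g}$ (in one variable it is the identity on $[0,1]$). For $m$-variate copulas $C,C'$, $\mathrm d_K(C,C')=\sup_{u\in[0,1]^m}|C(u)-C'(u)|$. *)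

theory Defs
  imports "HOL-Probability.Probability"
begin

definition unit_cube :: "'i set \<Rightarrow> ('i \<Rightarrow> real) set" where
  "unit_cube J = (J \<rightarrow>\<^sub>E {0..1})"

definition joint_cdf :: "'i set \<Rightarrow> ('i \<Rightarrow> real) measure \<Rightarrow> ('i \<Rightarrow> real) \<Rightarrow> real" where
  "joint_cdf J M u = measure M {x \<in> space M. \<forall>j\<in>J. x j \<le> u j}"

(* Only the values of C on the cube matter: this is the restriction of a distribution
   function on \<real>^J to [0,1]^J. An m-variate copula is a copula on {1..m}. *)
definition copula_on :: "'i set \<Rightarrow> (('i \<Rightarrow> real) \<Rightarrow> real) \<Rightarrow> bool" where
  "copula_on J C \<longleftrightarrow>
     (\<exists>M. prob_space M \<and>
          sets M = sets (Pi\<^sub>M J (\<lambda>_. borel)) \<and>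
          (\<forall>j\<in>J. distr M borel (\<lambda>x. x j) = uniform_measure lborel {0..1}) \<and>
          (\<forall>u\<in>unit_cube J. C u = joint_cdf J M u))"

(* A supremum of reals; the set is bounded whenever C and C' are copulas on J. *)
definition dK :: "'i set \<Rightarrow> (('i \<Rightarrow> real) \<Rightarrow> real) \<Rightarrow> (('i \<Rightarrow> real) \<Rightarrow> real) \<Rightarrow> real" where
  "dK J C C' = (SUP u\<in>unit_cube J. \<bar>C u - C' u\<bar>)"

definition nested ::
  "nat \<Rightarrow> (nat \<Rightarrow> nat set) \<Rightarrow> ((nat \<Rightarrow> real) \<Rightarrow> real) \<Rightarrow> (nat \<Rightarrow> (nat \<Rightarrow> real) \<Rightarrow> real)
    \<Rightarrow> (nat \<Rightarrow> real) \<Rightarrow> real" where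
  "nested G I R A u = R (\<lambda>g\<in>{1..G}. A g (restrict u (I g)))"

end

theory Submission
  imports Defs
begin

text \<open>
  The key point is that a copula is 1-Lipschitz for the \<open>\<ell>\<^sup>1\<close> distance
  (lemma \<open>copula_on_lipschitz\<close>): the part of the box below \<open>u\<close> that is not below \<open>v\<close> is
  covered by the slabs \<open>v j < x j \<le> u j\<close>, and by uniformity of the margins such a slab has
  probability at most \<open>\<bar>u j - v j\<bar>\<close>. Given \<open>u\<close>, put \<open>a\<^sub>k = (A\<^sub>k\<^sub>,\<^sub>g(u\<^sub>I\<^sub>g))\<^sub>g\<close>,
  which is a point of the unit cube. Then
  \<open>\<bar>R\<^sub>1(a\<^sub>1) - R\<^sub>2(a\<^sub>2)\<bar> \<le> \<bar>R\<^sub>1(a\<^sub>1) - R\<^sub>2(a\<^sub>1)\<bar> + \<bar>R\<^sub>2(a\<^sub>1) - R\<^sub>2(a\<^sub>2)\<bar>\<close>,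
  where the first term is at most the distance of \<open>R\<^sub>1\<close> and \<open>R\<^sub>2\<close>, and the second is bounded, by
  the Lipschitz property of \<open>R\<^sub>2\<close>, by the sum of the distances of the inner copulas.
\<close>

lemma unit_cube_nonempty: "unit_cube J \<noteq> {}"
  by (auto simp: unit_cube_def PiE_eq_empty_iff)

lemma copula_on_range:
  assumes "copula_on J C" "u \<in> unit_cube J"
  shows "C u \<in> {0..1}"
proof -
  from assms obtain M where "prob_space M" "C u = joint_cdf J M u"
    by (auto simp: copula_on_def)
  then show ?thesis
    by (auto simp: joint_cdf_def prob_space.prob_le_1)
qed

lemma dK_upper:
  assumes "copula_on J C" "copula_on J C'" "u \<in> unit_cube J"
  shows "\<bar>C u - C' u\<bar> \<le> dK J C C'"
  unfolding dK_def
proof (rule cSUP_upper[OF assms(3)])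
  have "\<bar>C x - C' x\<bar> \<le> 1" if "x \<in> unit_cube J" for x
    using copula_on_range[OF assms(1) that] copula_on_range[OF assms(2) that] by auto
  then show "bdd_above ((\<lambda>u. \<bar>C u - C' u\<bar>) ` unit_cube J)"
    by (auto simp: bdd_above_def)
qed

lemma measure_uniform_unit_Ioc:
  fixes a b :: real
  assumes "a \<in> {0..1}" "b \<in> {0..1}"
  shows "measure (uniform_measure lborel {0..1::real}) {a<..b} = max 0 (b - a)"
proof -
  have "{0..1} \<inter> {a<..b} = {a<..b}"
    using assms by auto
  then show ?thesis
    by (cases "a \<le> b") (simp_all add: measure_uniform_measure)
qed

lemma copula_on_diff_le:
  assumes J: "finite J" and C: "copula_on J C"
    and u: "u \<in> unit_cube J" and v: "v \<in> unit_cube J"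
  shows "C u - C v \<le> (\<Sum>j\<in>J. \<bar>u j - v j\<bar>)"
proof -
  from C obtain M where M: "prob_space M" "sets M = sets (Pi\<^sub>M J (\<lambda>_. borel))"
    and marg: "\<And>j. j \<in> J \<Longrightarrow> distr M borel (\<lambda>x. x j) = uniform_measure lborel {0..1}"
    and CM: "\<And>w. w \<in> unit_cube J \<Longrightarrow> C w = joint_cdf J M w"
    by (auto simp: copula_on_def)
  interpret prob_space M by fact
  have meas: "(\<lambda>x. x j) \<in> borel_measurable M" if "j \<in> J" for j
    using measurable_component_singleton[OF that, of "\<lambda>_. borel"]
    by (simp add: measurable_cong_sets[OF M(2) refl])
  define B where "B w = {x \<in> space M. \<forall>j\<in>J. x j \<le> w j}" for w :: "'a \<Rightarrow> real"
  define S where "S j = (\<lambda>x. x j) -` {v j<..u j} \<inter> space M" for j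
  have B: "B w \<in> sets M" for w
  proof -
    have "{x \<in> space M. x j \<le> w j} \<in> sets M" if "j \<in> J" for j
      using meas[OF that] by measurable
    then show ?thesis
      unfolding B_def using J by (intro sets.sets_Collect_finite_All) auto
  qed
  have S: "S j \<in> sets M" if "j \<in> J" for j
    unfolding S_def using meas[OF that] by (rule measurable_sets) simp
  have slab: "prob (S j) \<le> \<bar>u j - v j\<bar>" if j: "j \<in> J" for j
  proof -
    have "prob (S j) = measure (distr M borel (\<lambda>x. x j)) {v j<..u j}"
      unfolding S_def by (subst measure_distr[OF meas[OF j]]) auto
    also have "\<dots> = max 0 (u j - v j)"
      unfolding marg[OF j] using u v j
      by (intro measure_uniform_unit_Ioc) (auto simp: unit_cube_def PiE_def Pi_def)
    finally show ?thesis by simp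
  qed
  have "B u \<subseteq> B v \<union> (\<Union>j\<in>J. S j)"
    by (auto simp: B_def S_def not_le)
  moreover have US: "(\<Union>j\<in>J. S j) \<in> sets M"
    using J S by auto
  ultimately have "prob (B u) \<le> prob (B v \<union> (\<Union>j\<in>J. S j))"
    using B by (intro finite_measure_mono) auto
  also have "\<dots> \<le> prob (B v) + prob (\<Union>j\<in>J. S j)"
    using B US by (rule measure_Un_le)
  also have "prob (\<Union>j\<in>J. S j) \<le> (\<Sum>j\<in>J. prob (S j))"
    using J S by (intro finite_measure_subadditive_finite) auto
  also have "\<dots> \<le> (\<Sum>j\<in>J. \<bar>u j - v j\<bar>)"
    by (intro sum_mono slab)
  finally show ?thesis
    using CM[OF u] CM[OF v] by (simp add: joint_cdf_def B_def)
qed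

lemma copula_on_lipschitz:
  assumes "finite J" "copula_on J C" "u \<in> unit_cube J" "v \<in> unit_cube J"
  shows "\<bar>C u - C v\<bar> \<le> (\<Sum>j\<in>J. \<bar>u j - v j\<bar>)"
  using copula_on_diff_le[OF assms] copula_on_diff_le[OF assms(1,2,4,3)]
  by (simp add: abs_le_iff abs_minus_commute)

theorem mainTheorem9:
  fixes d G :: nat
    and I :: "nat \<Rightarrow> nat set"
    and R :: "nat \<Rightarrow> (nat \<Rightarrow> real) \<Rightarrow> real"
    and A :: "nat \<Rightarrow> nat \<Rightarrow> (nat \<Rightarrow> real) \<Rightarrow> real"
  assumes "d \<ge> 2"
    and "partition_on {1..d} (I ` {1..G})"
    and "inj_on I {1..G}"
    and "\<And>k. k \<in> {1, 2} \<Longrightarrow> copula_on {1..G} (R k)"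
    and "\<And>k g. k \<in> {1, 2} \<Longrightarrow> g \<in> {1..G} \<Longrightarrow> copula_on (I g) (A k g)"
    and "\<And>k. k \<in> {1, 2} \<Longrightarrow> copula_on {1..d} (nested G I (R k) (A k))"
  shows "dK {1..d} (nested G I (R 1) (A 1)) (nested G I (R 2) (A 2))
           \<le> dK {1..G} (R 1) (R 2) + (\<Sum>g=1..G. dK (I g) (A 1 g) (A 2 g))"
  unfolding dK_def[of "{1..d}"]
proof (rule cSUP_least[OF unit_cube_nonempty])
  fix u :: "nat \<Rightarrow> real"
  assume u: "u \<in> unit_cube {1..d}"
  define a where "a k = (\<lambda>g\<in>{1..G}. A k g (restrict u (I g)))" for k
  have uI: "restrict u (I g) \<in> unit_cube (I g)" if "g \<in> {1..G}" for g
  proof -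
    have "I g \<subseteq> {1..d}"
      using assms(2) that by (auto simp: partition_on_def)
    then show ?thesis
      using u by (auto simp: unit_cube_def PiE_def Pi_def subset_iff)
  qed
  have a: "a k \<in> unit_cube {1..G}" if k: "k \<in> {1, 2}" for k
  proof -
    have "A k g (restrict u (I g)) \<in> {0..1}" if "g \<in> {1..G}" for g
      using copula_on_range[OF assms(5)[OF k that] uI[OF that]] .
    then show ?thesis
      by (auto simp: unit_cube_def a_def)
  qed
  have "\<bar>R 1 (a 1) - R 2 (a 1)\<bar> \<le> dK {1..G} (R 1) (R 2)"
    using assms(4) a by (intro dK_upper) auto
  moreover have "\<bar>R 2 (a 1) - R 2 (a 2)\<bar> \<le> (\<Sum>g=1..G. \<bar>a 1 g - a 2 g\<bar>)"
    using assms(4) a by (intro copula_on_lipschitz) auto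
  moreover have "(\<Sum>g=1..G. \<bar>a 1 g - a 2 g\<bar>) \<le> (\<Sum>g=1..G. dK (I g) (A 1 g) (A 2 g))"
  proof (rule sum_mono)
    fix g assume g: "g \<in> {1..G}"
    have "\<bar>A 1 g (restrict u (I g)) - A 2 g (restrict u (I g))\<bar> \<le> dK (I g) (A 1 g) (A 2 g)"
      using assms(5) g by (intro dK_upper uI) auto
    then show "\<bar>a 1 g - a 2 g\<bar> \<le> dK (I g) (A 1 g) (A 2 g)"
      using g by (simp add: a_def)
  qed
  ultimately have "\<bar>R 1 (a 1) - R 2 (a 2)\<bar>
      \<le> dK {1..G} (R 1) (R 2) + (\<Sum>g=1..G. dK (I g) (A 1 g) (A 2 g))"
    by linarith
  then show "\<bar>nested G I (R 1) (A 1) u - nested G I (R 2) (A 2) u\<bar>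
      \<le> dK {1..G} (R 1) (R 2) + (\<Sum>g=1..G. dK (I g) (A 1 g) (A 2 g))"
    by (simp add: nested_def a_def)
qed

end
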